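(* Let $n\ge 1$, let $\lambda$ be a partition of $n$, and let $\mu_1=\lambda(c_1\to a_1)$ and $\mu_2=\lambda(c_2\to a_2)$ be obtained from $\lambda$ by admissible transfers, with $\mu_1\neq\mu_2$. Then the vertices $\lambda,\mu_1,\mu_2$ form a triangle in $G_n$ if and only if $c_1=c_2$ or $a_1=a_2$.
   Context: A partition of $n$ is a weakly decreasing sequence $\lambda=(\lambda_1\ge\cdots\ge\lambda_\ell>0)$ of positive integers with sum $n$, identified with its Ferrers diagram ($\lambda_i$ left-justified cells in row $i$); set $\lambda_{\ell+1}=0$. The partition graph $G_n$ has as vertices all partitions of $n$; two distinct partitions are adjacent if one is obtained from the other by removing one cell from a row, adding it to another row (possibly a new row of length $0$), and reordering the row lengths into weakly decreasing order. A triangle is a set of three pairwise adjacent vertices. A removable corner of $\lambda$ is the last cell of a row whose length is strictly greater than that of the next row; an addable corner is a position where a cell can be added so that the result is again a Ferrers diagram of a partition (row $\ell+1$ allowed). Write $r(\cdot)$ for the row number of a corner. For a removable corner $c$ and an addable corner $a$ of $\lambda$ with $r(c)\ne r(a)$, remove $c$ (decrease $\lambda_{r(c)}$ by $1$), add a cell at $a$ (increase $\lambda_{r(a)}$ by $1$), and reorder row lengths. If the result is a partition of $n$ different from $\lambda$, the transfer is called admissible and the result is denoted $\lambda(c\to a)$. The neighbors of $\lambda$ in $G_n$ are exactly the partitions $\lambda(c\to a)$ for admissible transfers. *)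

theory Defs
  imports Main
begin

text \<open>A partition is the list of its parts in weakly decreasing order. Rows and columns are
  numbered from 0, so that row \<open>i\<close> of \<open>lam\<close> has length \<open>lam ! i\<close> and the row
  below the last one has index \<open>length lam\<close>.\<close>

definition partitions :: "nat \<Rightarrow> nat list set" where
  "partitions n = {lam. sorted_wrt (\<ge>) lam \<and> (\<forall>x \<in> set lam. 0 < x) \<and> sum_list lam = n}"

definition part :: "nat list \<Rightarrow> nat \<Rightarrow> nat" where
  "part lam i = (if i < length lam then lam ! i else 0)"

definition diagram :: "nat list \<Rightarrow> (nat \<times> nat) set" where
  "diagram lam = {(i, j). i < length lam \<and> j < lam ! i}"

text \<open>Remove a cell from row \<open>i\<close>, add one to row \<open>j\<close>, and reorder. The appended
  row of length 0 is the possible new row \<open>j = length lam\<close>; rows of length 0 are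
  dropped at the end. Only meant for \<open>i < length lam\<close>, \<open>j \<le> length lam\<close>,
  \<open>i \<noteq> j\<close>.\<close>

definition move_cell :: "nat list \<Rightarrow> nat \<Rightarrow> nat \<Rightarrow> nat list" where
  "move_cell lam i j =
     rev (sort (filter (\<lambda>x. 0 < x)
       ((lam @ [0])[i := part lam i - 1, j := part lam j + 1])))"

definition obtained_by_move :: "nat list \<Rightarrow> nat list \<Rightarrow> bool" where
  "obtained_by_move lam mu \<longleftrightarrow>
     (\<exists>i j. i < length lam \<and> j \<le> length lam \<and> i \<noteq> j \<and> mu = move_cell lam i j)"

text \<open>The graph \<open>G\<^sub>n\<close> has vertex set \<open>partitions n\<close> and the following
  adjacency relation.\<close>

definition adjacent :: "nat \<Rightarrow> nat list \<Rightarrow> nat list \<Rightarrow> bool" where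
  "adjacent n lam mu \<longleftrightarrow>
     lam \<in> partitions n \<and> mu \<in> partitions n \<and> lam \<noteq> mu \<and>
     (obtained_by_move lam mu \<or> obtained_by_move mu lam)"

definition triangle :: "nat \<Rightarrow> nat list set \<Rightarrow> bool" where
  "triangle n T \<longleftrightarrow> T \<subseteq> partitions n \<and> card T = 3 \<and> pairwise (adjacent n) T"

definition removable_corner :: "nat list \<Rightarrow> nat \<times> nat \<Rightarrow> bool" where
  "removable_corner lam c \<longleftrightarrow>
     (case c of (i, j) \<Rightarrow>
        i < length lam \<and> part lam i > part lam (Suc i) \<and> Suc j = part lam i)"

definition addable_corner :: "nat list \<Rightarrow> nat \<times> nat \<Rightarrow> bool" where
  "addable_corner lam a \<longleftrightarrow>
     a \<notin> diagram lam \<and> (\<exists>m. \<exists>mu \<in> partitions m. diagram mu = insert a (diagram lam))"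

definition transfer :: "nat list \<Rightarrow> nat \<times> nat \<Rightarrow> nat \<times> nat \<Rightarrow> nat list" where
  "transfer lam c a = move_cell lam (fst c) (fst a)"

definition admissible :: "nat \<Rightarrow> nat list \<Rightarrow> nat \<times> nat \<Rightarrow> nat \<times> nat \<Rightarrow> bool" where
  "admissible n lam c a \<longleftrightarrow>
     removable_corner lam c \<and> addable_corner lam a \<and> fst c \<noteq> fst a \<and>
     transfer lam c a \<in> partitions n \<and> transfer lam c a \<noteq> lam"

end

theory Submission
  imports Defs "HOL-Library.Multiset"
begin

text \<open>Pass to conjugate partitions. Moving a cell from a row of length \<open>p + 1\<close> to a row of
  length \<open>q\<close> takes one cell from column \<open>p\<close> and gives it to column \<open>q\<close>, whatever reordering
  happens; conversely, two distinct partitions whose column lengths differ by such a unit transfer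
  are adjacent. The column lengths of \<open>\<mu>\<^sub>1\<close> and \<open>\<mu>\<^sub>2\<close> differ by
  \<open>\<delta>(q\<^sub>1) - \<delta>(p\<^sub>1) - \<delta>(q\<^sub>2) + \<delta>(p\<^sub>2)\<close>. Since \<open>p\<^sub>1 \<noteq> q\<^sub>1\<close> and \<open>p\<^sub>2 \<noteq> q\<^sub>2\<close>, this is a
  unit transfer exactly when \<open>p\<^sub>1 = p\<^sub>2\<close> or \<open>q\<^sub>1 = q\<^sub>2\<close>, and a corner is determined by its column.\<close>

text \<open>Part \<open>k\<close> of the conjugate partition, in a form that also makes sense for
  the unsorted lists with zeros inside \<open>move_cell\<close>.\<close>

definition col :: "nat list \<Rightarrow> nat \<Rightarrow> nat" where
  "col xs k = length (filter (\<lambda>x. k < x) xs)"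

text \<open>The losing column \<open>p\<close> stands on the left, so that no truncated subtraction
  occurs.\<close>

definition unit_transfer :: "nat list \<Rightarrow> nat list \<Rightarrow> nat \<Rightarrow> nat \<Rightarrow> bool" where
  "unit_transfer lam mu p q \<longleftrightarrow>
     (\<forall>k. col mu k + of_bool (k = p) = col lam k + of_bool (k = q))"

section \<open>Column lengths and recovery of the partition\<close>

lemma col_list_update:
  assumes "i < length xs"
  shows "col (xs[i := v]) k + of_bool (k < xs ! i) = col xs k + of_bool (k < v)"
  using assms
proof (induction xs arbitrary: i)
  case (Cons x xs)
  show ?case
  proof (cases i)
    case (Suc j)
    then show ?thesis using Cons.IH[of j] Cons.prems by (simp add: col_def)
  qed (simp add: col_def)
qed simp

lemma col_mset_cong: "mset xs = mset ys \<Longrightarrow> col xs k = col ys k"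
  unfolding col_def by (metis mset_filter size_mset)

lemma col_filter_pos: "col (filter (\<lambda>x. 0 < x) xs) k = col xs k"
  unfolding col_def by (induction xs) auto

lemma col_Suc: "col xs k = col xs (Suc k) + count_list xs (Suc k)"
  unfolding col_def by (induction xs) auto

lemma col_antimono: "k \<le> l \<Longrightarrow> col xs l \<le> col xs k"
  unfolding col_def by (induction xs) auto

lemma partitionsD:
  assumes "lam \<in> partitions n"
  shows "sorted_wrt (\<ge>) lam" "0 \<notin> set lam"
  using assms by (auto simp: partitions_def)

text \<open>By \<open>col_Suc\<close>, consecutive column lengths differ by the multiplicity of a
  positive part, so the multisets agree; sortedness then fixes the order. Zeros are invisible to
  \<open>col\<close>.\<close>

lemma eq_if_col_eq:
  assumes "sorted_wrt (\<ge>) xs" "0 \<notin> set xs" "sorted_wrt (\<ge>) ys" "0 \<notin> set ys"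
    and "\<And>k. col xs k = col ys k"
  shows "xs = ys"
proof -
  have "count_list xs x = count_list ys x" for x
  proof (cases x)
    case 0
    then show ?thesis using assms by (metis count_list_0_iff)
  next
    case (Suc k)
    then show ?thesis using col_Suc[of xs k] col_Suc[of ys k] assms(5) by simp
  qed
  then have "mset xs = mset ys"
    by (intro multiset_eqI) (simp add: count_mset)
  then have "mset (rev xs) = mset (rev ys)" by simp
  moreover have "sorted (rev xs)" "sorted (rev ys)"
    using assms by (simp_all add: sorted_wrt_rev)
  ultimately have "rev xs = rev ys"
    by (metis properties_for_sort)
  then show ?thesis by simp
qed

section \<open>Adjacency as unit transfer between columns\<close>

lemma move_cell_normal:
  "sorted_wrt (\<ge>) (move_cell lam i j)" "0 \<notin> set (move_cell lam i j)"
  by (auto simp: move_cell_def sorted_wrt_rev)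

text \<open>The last cell of a row of length \<open>Suc p\<close> lies in column \<open>p\<close>,
  and a row of length q is extended in column q. Sorting and dropping zeros leave column lengths
  unchanged.\<close>

lemma unit_transfer_move_cell:
  assumes "i < length lam" "j \<le> length lam" "i \<noteq> j" "part lam i = Suc p"
  shows "unit_transfer lam (move_cell lam i j) p (part lam j)"
  unfolding unit_transfer_def
proof
  fix k
  let ?xs = "lam @ [0]" and ?v = "part lam i - 1" and ?w = "part lam j + 1"
  \<comment> \<open>The default value 0 of \<open>part\<close> matches the appended empty row, which
    covers \<open>j = length lam\<close>.\<close>
  have part: "part lam l = ?xs ! l" if "l \<le> length lam" for l
    using that by (auto simp: Defs.part_def nth_append)
  have "col (move_cell lam i j) k = col (?xs[i := ?v, j := ?w]) k"
    unfolding move_cell_def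
    by (subst col_filter_pos[symmetric]) (rule col_mset_cong, simp)
  moreover have "col (?xs[i := ?v, j := ?w]) k + of_bool (k < part lam j)
      = col (?xs[i := ?v]) k + of_bool (k < ?w)"
    using col_list_update[of j "?xs[i := ?v]" ?w k] assms part[of j] by simp
  moreover have "col (?xs[i := ?v]) k + of_bool (k < part lam i) = col ?xs k + of_bool (k < ?v)"
    using col_list_update[of i ?xs ?v k] assms part[of i] by simp
  moreover have "col ?xs k = col lam k" by (simp add: col_def)
  moreover have "of_bool (k < Suc m) = of_bool (k < m) + (of_bool (k = m) :: nat)" for m
    by auto
  ultimately show "col (move_cell lam i j) k + of_bool (k = p) = col lam k + of_bool (k = part lam j)"
    using assms(4) by simp
qed

lemma unit_transfer_if_obtained_by_move:
  assumes "lam \<in> partitions n" "obtained_by_move lam mu"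
  shows "\<exists>p q. unit_transfer lam mu p q"
proof -
  obtain i j where ij: "i < length lam" "j \<le> length lam" "i \<noteq> j" "mu = move_cell lam i j"
    using assms(2) by (auto simp: obtained_by_move_def)
  have "lam ! i \<noteq> 0" using partitionsD(2)[OF assms(1)] ij(1) by (metis nth_mem)
  then obtain p where "part lam i = Suc p" using ij(1) not0_implies_Suc by (auto simp: Defs.part_def)
  from unit_transfer_move_cell[OF ij(1-3) this] show ?thesis unfolding ij(4) by (intro exI)
qed

lemma unit_transfer_sym: "unit_transfer lam mu p q \<longleftrightarrow> unit_transfer mu lam q p"
  unfolding unit_transfer_def by metis

lemma obtained_by_move_if_unit_transfer:
  assumes "lam \<in> partitions n" "mu \<in> partitions n" "unit_transfer lam mu p q" "p \<noteq> q"
  shows "obtained_by_move lam mu"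
proof -
  have eq: "col mu k + of_bool (k = p) = col lam k + of_bool (k = q)" for k
    using assms(3) by (simp add: unit_transfer_def)
  have count: "count_list lam x = card {i. i < length lam \<and> lam ! i = x}" for x
    by (simp add: count_list_eq_length_filter length_filter_conv_card eq_commute)
  \<comment> \<open>Column \<open>p\<close> of \<open>mu\<close> is one shorter than that of
    \<open>lam\<close>, yet still at least as long as column \<open>Suc p\<close> of
    \<open>mu\<close>. If \<open>q = Suc p\<close>, the latter has also grown by one, so
    \<open>lam\<close> has two rows of length \<open>Suc p\<close>.\<close>
  have p: "1 + of_bool (q = Suc p) \<le> count_list lam (Suc p)"
    using eq[of p] eq[of "Suc p"] col_antimono[of p "Suc p" mu] col_Suc[of lam p] assms(4)
    by (auto split: if_splits)
  then have "{i. i < length lam \<and> lam ! i = Suc p} \<noteq> {}"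
    unfolding count by fastforce
  then obtain i where i: "i < length lam" "lam ! i = Suc p" by blast
  have "\<exists>j. j \<le> length lam \<and> i \<noteq> j \<and> part lam j = q"
  proof (cases q)
    case 0
    then show ?thesis using i(1) by (intro exI[of _ "length lam"]) (auto simp: Defs.part_def)
  next
    case (Suc r)
    \<comment> \<open>Column \<open>q\<close> of \<open>mu\<close> has gained a cell, but column
      \<open>r\<close> has not, so in \<open>lam\<close> column \<open>r\<close> is strictly longer
      than column \<open>q\<close>.\<close>
    have "1 \<le> count_list lam q"
      using eq[of r] eq[of q] col_antimono[of r q mu] col_Suc[of lam r] assms(4) Suc
      by (auto split: if_splits)
    with p have "1 + of_bool (q = Suc p) \<le> card {j. j < length lam \<and> lam ! j = q}"
      unfolding count by auto
    \<comment> \<open>Row \<open>i\<close> itself has length \<open>q\<close> exactly when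
      \<open>q = Suc p\<close>; the stronger count then supplies a second row.\<close>
    moreover have "card {j. j < length lam \<and> lam ! j = q} \<le> of_bool (q = Suc p)"
      if "{j. j < length lam \<and> lam ! j = q} \<subseteq> {i}"
    proof (cases "q = Suc p")
      case True
      then show ?thesis using card_mono[OF _ that] by simp
    next
      case False
      then have "{j. j < length lam \<and> lam ! j = q} = {}" using that i by blast
      then show ?thesis by (metis card.empty le0)
    qed
    ultimately have "\<not> {j. j < length lam \<and> lam ! j = q} \<subseteq> {i}" by fastforce
    then obtain j where "j < length lam" "lam ! j = q" "j \<noteq> i" by blast
    then show ?thesis by (intro exI[of _ j]) (auto simp: Defs.part_def)
  qed
  then obtain j where j: "j \<le> length lam" "i \<noteq> j" "part lam j = q" by blast
  have "unit_transfer lam (move_cell lam i j) p q"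
    using unit_transfer_move_cell[of i lam j p] i j by (simp add: Defs.part_def)
  then have "col mu k = col (move_cell lam i j) k" for k
    using eq[of k] unfolding unit_transfer_def by (metis add_right_cancel)
  then have "mu = move_cell lam i j"
    using eq_if_col_eq partitionsD[OF assms(2)] move_cell_normal by metis
  then show ?thesis unfolding obtained_by_move_def using i j by blast
qed

lemma eq_if_unit_transfer_refl:
  assumes "lam \<in> partitions n" "mu \<in> partitions n" "unit_transfer lam mu p p"
  shows "lam = mu"
  using assms eq_if_col_eq[of lam mu] partitionsD
  by (auto simp: unit_transfer_def)

text \<open>The case \<open>p = q\<close> is excluded because equal columns would force
  \<open>lam = mu\<close>.\<close>

lemma adjacent_iff_unit_transfer:
  assumes "lam \<in> partitions n" "mu \<in> partitions n" "lam \<noteq> mu"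
  shows "adjacent n lam mu \<longleftrightarrow> (\<exists>p q. unit_transfer lam mu p q)"
proof
  assume "adjacent n lam mu"
  then show "\<exists>p q. unit_transfer lam mu p q"
    unfolding adjacent_def
    using unit_transfer_if_obtained_by_move unit_transfer_sym assms by metis
next
  assume "\<exists>p q. unit_transfer lam mu p q"
  then obtain p q where pq: "unit_transfer lam mu p q" by blast
  then have "p \<noteq> q" using eq_if_unit_transfer_refl assms by blast
  then show "adjacent n lam mu"
    unfolding adjacent_def using obtained_by_move_if_unit_transfer assms pq by blast
qed

lemma adjacent_sym: "adjacent n lam mu \<longleftrightarrow> adjacent n mu lam"
  by (auto simp: adjacent_def)

section \<open>Corners of a Ferrers diagram\<close>

lemma diagram_downward_closed:
  assumes "lam \<in> partitions n" "(i, j) \<in> diagram lam" "i' \<le> i" "j' \<le> j"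
  shows "(i', j') \<in> diagram lam"
proof -
  have "lam ! i \<le> lam ! i'"
    using sorted_wrt_nth_less[OF partitionsD(1)[OF assms(1)], of i' i] assms(2,3)
    by (cases "i' = i") (auto simp: diagram_def)
  then show ?thesis using assms by (auto simp: diagram_def)
qed

text \<open>The enlarged diagram is closed upwards and to the left, so every cell above or to the
  left of the new one already lies in \<open>lam\<close>.\<close>

lemma addable_cornerD:
  assumes "addable_corner lam (i, j)"
  shows "part lam i = j" "i \<le> length lam" "\<And>i'. i' < i \<Longrightarrow> (i', j) \<in> diagram lam"
    "(i, j) \<notin> diagram lam"
proof -
  obtain m mu where mu: "mu \<in> partitions m" "diagram mu = insert (i, j) (diagram lam)"
    using assms by (auto simp: addable_corner_def)
  show notin: "(i, j) \<notin> diagram lam" using assms by (simp add: addable_corner_def)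
  show above: "(i', j) \<in> diagram lam" if "i' < i" for i'
    using diagram_downward_closed[OF mu(1), of i j i' j] that mu(2) by auto
  have left: "(i, j') \<in> diagram lam" if "j' < j" for j'
    using diagram_downward_closed[OF mu(1), of i j i j'] that mu(2) by auto
  have "\<not> part lam i < j"
  proof
    assume "part lam i < j"
    from left[OF this] show False by (auto simp: diagram_def Defs.part_def split: if_splits)
  qed
  moreover have "\<not> j < part lam i"
    using notin by (auto simp: diagram_def Defs.part_def split: if_splits)
  ultimately show "part lam i = j" by simp
  show "i \<le> length lam"
  proof (rule ccontr)
    assume "\<not> i \<le> length lam"
    then show False using above[of "length lam"] by (simp add: diagram_def)
  qed
qed

text \<open>The upper of two such corners would lie above the lower one, hence already in the
  diagram.\<close>

lemma addable_corner_col_inj: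
  assumes "addable_corner lam (i, j)" "addable_corner lam (i', j)"
  shows "i = i'"
  using addable_cornerD[OF assms(1)] addable_cornerD[OF assms(2)] by (metis linorder_cases)

lemma removable_corner_col_inj:
  assumes "lam \<in> partitions n" "removable_corner lam (i, j)" "removable_corner lam (i', j)"
  shows "i = i'"
proof -
  have "\<not> k < l" if "removable_corner lam (k, j)" "removable_corner lam (l, j)" for k l
  proof
    \<comment> \<open>The cell just below the upper corner would lie in the diagram, but row
      \<open>Suc k\<close> is too short to reach column \<open>j\<close>.\<close>
    assume "k < l"
    then have "(Suc k, j) \<in> diagram lam"
      using diagram_downward_closed[OF assms(1), of l j "Suc k" j] that
      by (auto simp: removable_corner_def diagram_def Defs.part_def split: if_splits)
    then show False using that
      by (auto simp: removable_corner_def diagram_def Defs.part_def split: if_splits)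
  qed
  then show ?thesis using assms(2,3) by (meson linorder_cases)
qed

section \<open>Two transfers from one partition\<close>

lemma admissible_unit_transfer:
  assumes "admissible n lam c a"
  shows "unit_transfer lam (transfer lam c a) (snd c) (snd a)"
  using assms unit_transfer_move_cell[of "fst c" lam "fst a" "snd c"]
    addable_cornerD(1,2)[of lam "fst a" "snd a"]
  by (auto simp: admissible_def removable_corner_def transfer_def)

lemma unit_transfer_common_source:
  assumes "unit_transfer lam mu p q" "unit_transfer lam nu p' q'" "p \<noteq> q" "p' \<noteq> q'"
  shows "(\<exists>r s. unit_transfer mu nu r s) \<longleftrightarrow> p = p' \<or> q = q'"
proof -
  have lam: "col mu k + of_bool (k = p) = col lam k + of_bool (k = q)"
    "col nu k + of_bool (k = p') = col lam k + of_bool (k = q')" for k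
    using assms(1,2) by (auto simp: unit_transfer_def)
  show ?thesis
  proof
    assume "\<exists>r s. unit_transfer mu nu r s"
    then obtain r s where "\<And>k. col nu k + of_bool (k = r) = col mu k + of_bool (k = s)"
      by (auto simp: unit_transfer_def)
    then have eq: "of_bool (k = q') + of_bool (k = p) + of_bool (k = r)
        = of_bool (k = q) + of_bool (k = p') + (of_bool (k = s) :: nat)" for k
      using lam[of k] by (smt (verit) add.assoc add.commute add_left_cancel)
    show "p = p' \<or> q = q'"
    proof (rule ccontr)
      assume ne: "\<not> (p = p' \<or> q = q')"
      \<comment> \<open>At \<open>p\<close> the left side of \<open>eq\<close> is positive, while
        \<open>q\<close> and \<open>p'\<close> contribute nothing on the right; only
        \<open>s\<close> can. The same holds at \<open>q'\<close>.\<close>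
      have "p = s"
        using eq[of p] ne assms(3) by (cases "p = s") simp_all
      moreover have "q' = s"
        using eq[of q'] ne assms(4) by (cases "q' = s") simp_all
      \<comment> \<open>With \<open>p = q' = s\<close>, the left side at \<open>p\<close> is at
        least 2 and the right side is 1.\<close>
      ultimately show False
        using eq[of p] ne assms(3) by simp
    qed
  next
    assume "p = p' \<or> q = q'"
    \<comment> \<open>With a common source column, the cell added at \<open>q\<close> goes to
      \<open>q'\<close> instead; with a common target, the cell taken from \<open>p\<close> is put
      back and one is taken from \<open>p'\<close>.\<close>
    then have "unit_transfer mu nu q q' \<or> unit_transfer mu nu p' p"
    proof
      assume "p = p'"
      then have "col nu k + of_bool (k = q) = col mu k + of_bool (k = q')" for k
        using lam[of k] by simp
      then show ?thesis by (simp add: unit_transfer_def)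
    next
      assume "q = q'"
      then have "col nu k + of_bool (k = p') = col mu k + of_bool (k = p)" for k
        using lam[of k] by simp
      then show ?thesis by (simp add: unit_transfer_def)
    qed
    then show "\<exists>r s. unit_transfer mu nu r s" by blast
  qed
qed

theorem theorem3p4:
  fixes n :: nat and lam mu1 mu2 :: "nat list" and c1 a1 c2 a2 :: "nat \<times> nat"
  assumes "n \<ge> 1"
    and "lam \<in> partitions n"
    and "admissible n lam c1 a1"
    and "admissible n lam c2 a2"
    and "mu1 = transfer lam c1 a1"
    and "mu2 = transfer lam c2 a2"
    and "mu1 \<noteq> mu2"
  shows "triangle n {lam, mu1, mu2} \<longleftrightarrow> c1 = c2 \<or> a1 = a2"
proof -
  have mu: "mu1 \<in> partitions n" "mu2 \<in> partitions n" "lam \<noteq> mu1" "lam \<noteq> mu2"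
    using assms by (auto simp: admissible_def)
  have ut: "unit_transfer lam mu1 (snd c1) (snd a1)" "unit_transfer lam mu2 (snd c2) (snd a2)"
    using assms admissible_unit_transfer by auto
  have ne: "snd c1 \<noteq> snd a1" "snd c2 \<noteq> snd a2"
    using ut mu assms(2) eq_if_unit_transfer_refl by metis+
  have "adjacent n lam mu1" "adjacent n lam mu2"
    using adjacent_iff_unit_transfer ut mu assms(2) by blast+
  then have "triangle n {lam, mu1, mu2} \<longleftrightarrow> adjacent n mu1 mu2"
    using mu assms(2,7) adjacent_sym by (auto simp: triangle_def pairwise_insert)
  also have "\<dots> \<longleftrightarrow> snd c1 = snd c2 \<or> snd a1 = snd a2"
    using adjacent_iff_unit_transfer[OF mu(1,2) assms(7)] unit_transfer_common_source[OF ut ne]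
    by simp
  \<comment> \<open>Column equality lifts to equality of corners, since a column contains at most
    one corner of each kind.\<close>
  also have "snd c1 = snd c2 \<longleftrightarrow> c1 = c2"
    using assms(2-4) removable_corner_col_inj unfolding admissible_def by (metis prod.collapse)
  also have "snd a1 = snd a2 \<longleftrightarrow> a1 = a2"
    using assms(3,4) addable_corner_col_inj unfolding admissible_def by (metis prod.collapse)
  finally show ?thesis .
qed

end
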